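(* Let $n\geq 2$, let $U,V\in\mathbb{M}_n$ be unitary matrices, and set $J=\frac12\bigl(\operatorname{Re}U+i\operatorname{Im}V\bigr)$. If $J$ is malnormal, i.e. $\operatorname{mal}(J)>0$, then $(U,V)$ is a quantum $\delta$-edge expander for some constant $\delta$ with $0\leq\delta\leq 1-\operatorname{mal}(J)^2$.
   Context: $\mathbb{M}_n$ denotes the complex $n\times n$ matrices, $[X,B]=XB-BX$, $\operatorname{tr}$ is the usual trace, $\tau(B)=\frac1n\operatorname{tr}(B)$, $\|B\|_2=\operatorname{tr}(B^*B)^{1/2}$, and $\dot B=B-\tau(B)I$. $\operatorname{Re}X=\frac12(X+X^* )$ and $\operatorname{Im}X=\frac1{2i}(X-X^* )$. A matrix $X\in\mathbb{M}_n$ is $\kappa$-malnormal if $\|[X,B]\|_2\geq\kappa\,\|\dot B\|_2$ for all self-adjoint $B\in\mathbb{M}_n$; $\operatorname{mal}(X)$ is the largest constant $\kappa$ for which $X$ is $\kappa$-malnormal; $X$ is malnormal if $\operatorname{mal}(X)>0$. A $k$-tuple $(U_1,\dots,U_k)$ of $n\times n$ unitaries is a quantum $\delta$-edge expander, for some $0\leq\delta<1$, if the map $\mathcal{E}(X)=\frac1k\sum_{i=1}^kU_i^*XU_i$ satisfies $\operatorname{tr}(\mathcal{E}(\dot B)\dot B)\leq\delta\operatorname{tr}(\dot B^2)$ for all self-adjoint $B\in\mathbb{M}_n$. *)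

theory Defs
  imports "HOL-Analysis.Analysis"
begin

text \<open>
  The matrix algebra \<open>\<bbbM>\<^sub>n\<close> is the type \<open>complex^'n^'n\<close>, with \<open>n = CARD('n)\<close>.
  The library's \<open>*s\<close> and \<open>*\<^sub>R\<close> do not provide multiplication of a matrix by a complex
  scalar, so it is introduced here.
\<close>

type_synonym 'n cmat = "complex^'n^'n"

definition cscale :: "complex \<Rightarrow> 'n::finite cmat \<Rightarrow> 'n cmat"  (infixr "*\<^sub>C" 75)
  where "c *\<^sub>C A = (\<chi> i j. c * A $ i $ j)"

definition conj_transpose :: "'n::finite cmat \<Rightarrow> 'n cmat"
  where "conj_transpose A = (\<chi> i j. cnj (A $ j $ i))"

definition self_adjoint :: "'n::finite cmat \<Rightarrow> bool"
  where "self_adjoint A \<longleftrightarrow> conj_transpose A = A"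

definition unitary :: "'n::finite cmat \<Rightarrow> bool"
  where "unitary U \<longleftrightarrow> conj_transpose U ** U = mat 1 \<and> U ** conj_transpose U = mat 1"

definition Re_mat :: "'n::finite cmat \<Rightarrow> 'n cmat"
  where "Re_mat X = (1 / 2) *\<^sub>C (X + conj_transpose X)"

definition Im_mat :: "'n::finite cmat \<Rightarrow> 'n cmat"
  where "Im_mat X = (1 / (2 * \<i>)) *\<^sub>C (X - conj_transpose X)"

definition commutator :: "'n::finite cmat \<Rightarrow> 'n cmat \<Rightarrow> 'n cmat"
  where "commutator X B = X ** B - B ** X"

definition norm_trace :: "'n::finite cmat \<Rightarrow> complex"
  where "norm_trace B = trace B / of_nat CARD('n)"

definition centered :: "'n::finite cmat \<Rightarrow> 'n cmat"
  where "centered B = B - norm_trace B *\<^sub>C mat 1"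

text \<open>\<open>tr(B\<^sup>*B)\<close> is a nonnegative real number, so passing to its real part loses nothing.\<close>

definition norm2 :: "'n::finite cmat \<Rightarrow> real"
  where "norm2 B = sqrt (Re (trace (conj_transpose B ** B)))"

definition kappa_malnormal :: "real \<Rightarrow> 'n::finite cmat \<Rightarrow> bool"
  where "kappa_malnormal \<kappa> X \<longleftrightarrow>
    (\<forall>B. self_adjoint B \<longrightarrow> norm2 (commutator X B) \<ge> \<kappa> * norm2 (centered B))"

text \<open>
  The greatest element exists whenever \<open>n \<ge> 2\<close>: the admissible constants then form a closed set
  that contains \<open>0\<close> and is bounded above. For \<open>n = 1\<close> every constant is admissible and
  \<open>mal X\<close> is unspecified.
\<close>

definition mal :: "'n::finite cmat \<Rightarrow> real"
  where "mal X = (GREATEST \<kappa>. kappa_malnormal \<kappa> X)"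

definition malnormal :: "'n::finite cmat \<Rightarrow> bool"
  where "malnormal X \<longleftrightarrow> mal X > 0"

text \<open>A \<open>k\<close>-tuple of matrices is a list of length \<open>k\<close>.\<close>

definition averaging_map :: "'n::finite cmat list \<Rightarrow> 'n cmat \<Rightarrow> 'n cmat"
  where "averaging_map Us X =
    (1 / of_nat (length Us)) *\<^sub>C (\<Sum>U\<leftarrow>Us. conj_transpose U ** X ** U)"

text \<open>Both traces below are real, since \<open>centered B\<close> and its image under the averaging map
  are self-adjoint.\<close>

definition quantum_edge_expander :: "real \<Rightarrow> 'n::finite cmat list \<Rightarrow> bool"
  where "quantum_edge_expander \<delta> Us \<longleftrightarrow>
    Us \<noteq> [] \<and> (\<forall>U\<in>set Us. unitary U) \<and> 0 \<le> \<delta> \<and> \<delta> < 1 \<and>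
    (\<forall>B. self_adjoint B \<longrightarrow>
      Re (trace (averaging_map Us (centered B) ** centered B))
        \<le> \<delta> * Re (trace (centered B ** centered B)))"

end

theory Submission
  imports Defs
begin

text \<open>
  For self-adjoint \<open>P\<close>, \<open>Q\<close>, \<open>D\<close> the matrix \<open>[P, D]\<close> is skew-adjoint and \<open>i[Q, D]\<close> is
  self-adjoint, so they are orthogonal for the real inner product \<open>Re tr(A\<^sup>*B)\<close>. With
  \<open>P = Re U\<close>, \<open>Q = Im V\<close> this gives
  \<open>4\<parallel>[J, D]\<parallel>\<^sup>2 = \<parallel>[P, D]\<parallel>\<^sup>2 + \<parallel>[Q, D]\<parallel>\<^sup>2 \<le> \<parallel>[U, D]\<parallel>\<^sup>2 + \<parallel>[V, D]\<parallel>\<^sup>2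
  = 4(\<parallel>D\<parallel>\<^sup>2 - tr(E(D)D))\<close>, so \<open>\<delta> = 1 - mal(J)\<^sup>2\<close> satisfies the expander inequality. It is
  nonnegative because some nonscalar self-adjoint \<open>B\<close> commutes with \<open>P\<close> (namely \<open>P\<close> itself,
  or anything if \<open>P\<close> is scalar), and then
  \<open>4 mal(J)\<^sup>2\<parallel>D\<parallel>\<^sup>2 \<le> \<parallel>[V, D]\<parallel>\<^sup>2 \<le> 4\<parallel>D\<parallel>\<^sup>2\<close> for the centered \<open>D\<close> of \<open>B\<close>.
\<close>

section \<open>Adjoints, complex scalars and traces of matrices\<close>

lemma conj_transpose_mult: "conj_transpose (A ** B) = conj_transpose B ** conj_transpose A"
  by (simp add: conj_transpose_def matrix_matrix_mult_def vec_eq_iff mult.commute)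

lemma conj_transpose_diff: "conj_transpose (A - B) = conj_transpose A - conj_transpose B"
  by (simp add: conj_transpose_def vec_eq_iff)

lemma conj_transpose_add: "conj_transpose (A + B) = conj_transpose A + conj_transpose B"
  by (simp add: conj_transpose_def vec_eq_iff)

lemma conj_transpose_cscale: "conj_transpose (c *\<^sub>C A) = cnj c *\<^sub>C conj_transpose A"
  by (simp add: conj_transpose_def cscale_def vec_eq_iff)

lemma conj_transpose_conj_transpose [simp]: "conj_transpose (conj_transpose A) = A"
  by (simp add: conj_transpose_def vec_eq_iff)

lemma conj_transpose_mat_1 [simp]: "conj_transpose (mat 1) = mat 1"
  by (auto simp: conj_transpose_def mat_def vec_eq_iff)

lemma cscale_mult_left: "(c *\<^sub>C A) ** B = c *\<^sub>C (A ** B)"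
  by (simp add: cscale_def matrix_matrix_mult_def vec_eq_iff sum_distrib_left mult.assoc)

lemma cscale_mult_right: "A ** (c *\<^sub>C B) = c *\<^sub>C (A ** B)"
  by (simp add: cscale_def matrix_matrix_mult_def vec_eq_iff sum_distrib_left mult_ac)

lemma cscale_diff: "c *\<^sub>C (A - B) = c *\<^sub>C A - c *\<^sub>C B"
  by (simp add: cscale_def vec_eq_iff algebra_simps)

lemma trace_cscale: "trace (c *\<^sub>C A) = c * trace A"
  by (simp add: trace_def cscale_def sum_distrib_left)

lemma trace_conj_transpose: "trace (conj_transpose A) = cnj (trace A)"
  by (simp add: trace_def conj_transpose_def)

section \<open>The real Hilbert-Schmidt inner product and its invariances\<close>

lemma inner_cmat_eq_trace: "A \<bullet> B = Re (trace (conj_transpose A ** B))"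
  for A B :: "complex^'n^'n"
proof -
  have "A \<bullet> B = (\<Sum>i\<in>UNIV. \<Sum>j\<in>UNIV. Re (cnj (A $ i $ j) * B $ i $ j))"
    by (simp add: inner_vec_def inner_complex_def)
  also have "\<dots> = (\<Sum>j\<in>UNIV. \<Sum>i\<in>UNIV. Re (cnj (A $ i $ j) * B $ i $ j))"
    by (rule sum.swap)
  finally show ?thesis
    by (simp add: trace_def conj_transpose_def matrix_matrix_mult_def)
qed

text \<open>Lets the Euclidean geometry of the matrix space, with its triangle inequality and
  orthogonality, be applied to the trace norm.\<close>

lemma norm2_eq_norm: "norm2 A = norm A"
  by (simp add: norm2_def norm_eq_sqrt_inner inner_cmat_eq_trace)

lemma inner_conj_transpose: "conj_transpose A \<bullet> conj_transpose B = A \<bullet> B"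
  for A B :: "complex^'n^'n"
proof -
  have "trace (A ** conj_transpose B) = trace (conj_transpose B ** A)"
    by (rule trace_mul_sym)
  then show ?thesis
    by (metis inner_cmat_eq_trace inner_commute conj_transpose_conj_transpose)
qed

lemma norm_conj_transpose: "norm (conj_transpose A) = norm A"
  for A :: "complex^'n^'n"
  by (simp add: norm_eq_sqrt_inner inner_conj_transpose)

lemma norm_cscale: "norm (c *\<^sub>C A) = cmod c * norm A"
  for A :: "complex^'n^'n"
proof -
  have "cmod c * norm A = norm (\<chi> i. (\<chi> j. c * A $ i $ j))"
    by (simp add: norm_vec_def norm_mult L2_set_right_distrib)
  then show ?thesis
    by (simp add: cscale_def)
qed

lemma norm_unitary_mult_left:
  fixes U A :: "complex^'n^'n"
  assumes "unitary U" shows "norm (U ** A) = norm A"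
proof -
  have "conj_transpose (U ** A) ** (U ** A) = conj_transpose A ** (conj_transpose U ** U) ** A"
    by (simp add: conj_transpose_mult matrix_mul_assoc)
  also have "\<dots> = conj_transpose A ** A"
    using assms by (simp add: unitary_def)
  finally show ?thesis
    by (simp add: norm_eq_sqrt_inner inner_cmat_eq_trace)
qed

lemma unitary_conj_transpose: "unitary U \<Longrightarrow> unitary (conj_transpose U)"
  by (simp add: unitary_def)

lemma norm_unitary_mult_right:
  fixes U A :: "complex^'n^'n"
  assumes "unitary U" shows "norm (A ** U) = norm A"
proof -
  have "norm (A ** U) = norm (conj_transpose U ** conj_transpose A)"
    by (metis norm_conj_transpose conj_transpose_mult)
  also have "\<dots> = norm A"
    using assms
    by (simp add: norm_unitary_mult_left unitary_conj_transpose norm_conj_transpose)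
  finally show ?thesis .
qed

section \<open>Commutators and centering\<close>

lemma matrix_add_rdistrib: "(A + B) ** C = A ** C + B ** C"
  for A B :: "'a::semiring_1^'n^'m"
  by (simp add: matrix_matrix_mult_def vec_eq_iff sum.distrib distrib_right)

lemma commutator_add_left: "commutator (X + Y) B = commutator X B + commutator Y B"
  by (simp add: commutator_def matrix_add_ldistrib matrix_add_rdistrib)

lemma commutator_diff_left: "commutator (X - Y) B = commutator X B - commutator Y B"
proof -
  have "commutator (X - Y + Y) B = commutator (X - Y) B + commutator Y B"
    by (rule commutator_add_left)
  then show ?thesis by simp
qed

lemma commutator_cscale_left: "commutator (c *\<^sub>C X) B = c *\<^sub>C commutator X B"
  by (simp add: commutator_def cscale_mult_left cscale_mult_right cscale_diff)

lemma commutator_centered: "commutator X (centered B) = commutator X B"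
proof -
  \<comment> \<open>Distributivity is applied to \<open>B\<close> split as \<open>centered B\<close>
    plus its scalar part, and then rearranged. The scalar part contributes the same term on both
    sides, so it cancels in the commutator.\<close>
  have "X ** centered B = X ** B - norm_trace B *\<^sub>C X"
    using matrix_add_ldistrib[of X "centered B" "norm_trace B *\<^sub>C mat 1"]
    by (simp add: centered_def cscale_mult_right eq_diff_eq)
  moreover have "centered B ** X = B ** X - norm_trace B *\<^sub>C X"
    using matrix_add_rdistrib[of "centered B" "norm_trace B *\<^sub>C mat 1" X]
    by (simp add: centered_def cscale_mult_left eq_diff_eq)
  ultimately show ?thesis
    by (simp add: commutator_def)
qed

lemma conj_transpose_commutator:
  "conj_transpose (commutator X B) = - commutator (conj_transpose X) (conj_transpose B)"
  by (simp add: commutator_def conj_transpose_diff conj_transpose_mult)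

text \<open>Taking adjoints is isometric and turns one commutator into minus the other.\<close>

lemma norm_commutator_conj_transpose:
  assumes "self_adjoint B" shows "norm (commutator (conj_transpose X) B) = norm (commutator X B)"
  by (metis assms conj_transpose_commutator norm_conj_transpose norm_minus_cancel self_adjoint_def)

section \<open>Self-adjoint parts and norm estimates for commutators\<close>

lemma self_adjoint_Re_mat: "self_adjoint (Re_mat X)"
  by (simp add: self_adjoint_def Re_mat_def conj_transpose_cscale conj_transpose_add add.commute)

lemma self_adjoint_Im_mat: "self_adjoint (Im_mat X)"
  by (simp add: self_adjoint_def Im_mat_def cscale_def conj_transpose_def vec_eq_iff field_simps)

lemma self_adjoint_centered:
  assumes "self_adjoint B" shows "self_adjoint (centered B)"
proof -
  have "cnj (norm_trace B) = norm_trace B"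
    using assms trace_conj_transpose[of B] by (simp add: norm_trace_def self_adjoint_def)
  then show ?thesis
    using assms
    by (simp add: self_adjoint_def centered_def conj_transpose_diff conj_transpose_cscale)
qed

text \<open>The commutator with \<open>Re_mat X\<close> is the mean of those with \<open>X\<close>
  and its adjoint, which have equal norm; the triangle inequality finishes. The imaginary part is
  handled in the same way.\<close>

lemma norm_commutator_Re_mat_le:
  assumes "self_adjoint B" shows "norm (commutator (Re_mat X) B) \<le> norm (commutator X B)"
  using norm_triangle_ineq[of "commutator X B" "commutator (conj_transpose X) B"]
    norm_commutator_conj_transpose[OF assms, of X]
  by (simp add: Re_mat_def commutator_cscale_left commutator_add_left norm_cscale norm_divide)

lemma norm_commutator_Im_mat_le:
  assumes "self_adjoint B" shows "norm (commutator (Im_mat X) B) \<le> norm (commutator X B)"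
  using norm_triangle_ineq4[of "commutator X B" "commutator (conj_transpose X) B"]
    norm_commutator_conj_transpose[OF assms, of X]
  by (simp add: Im_mat_def commutator_cscale_left commutator_diff_left norm_cscale norm_divide norm_mult)

lemma norm_commutator_unitary_le:
  assumes "unitary U" shows "norm (commutator U D) \<le> 2 * norm D"
  using norm_triangle_ineq4[of "U ** D" "D ** U"]
  by (simp add: commutator_def norm_unitary_mult_left norm_unitary_mult_right assms)

text \<open>Both products with \<open>U\<close> have the norm of \<open>D\<close>, so expanding the
  square leaves only the cross term. By cyclicity of the trace this is the summand that
  \<open>U\<close> contributes to the averaging map.\<close>

lemma norm_commutator_unitary_sq:
  assumes U: "unitary U" and D: "self_adjoint D"
  shows "(norm (commutator U D))\<^sup>2
    = 2 * (norm D)\<^sup>2 - 2 * Re (trace (conj_transpose U ** D ** U ** D))"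
proof -
  have "trace (conj_transpose (U ** D) ** (D ** U)) = trace (D ** (conj_transpose U ** D ** U))"
    using D by (simp add: conj_transpose_mult self_adjoint_def matrix_mul_assoc)
  also have "\<dots> = trace (conj_transpose U ** D ** U ** D)"
    by (rule trace_mul_sym)
  finally have "(U ** D) \<bullet> (D ** U) = Re (trace (conj_transpose U ** D ** U ** D))"
    by (simp add: inner_cmat_eq_trace)
  moreover have "(norm (U ** D - D ** U))\<^sup>2
      = (norm (U ** D))\<^sup>2 + (norm (D ** U))\<^sup>2 - 2 * ((U ** D) \<bullet> (D ** U))"
    by (simp add: power2_norm_eq_inner inner_diff_left inner_diff_right inner_commute)
  ultimately show ?thesis
    by (simp add: commutator_def norm_unitary_mult_left norm_unitary_mult_right U)
qed

lemma norm_commutator_cartesian_sq: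
  assumes "self_adjoint P" "self_adjoint Q" "self_adjoint D"
  shows "4 * (norm (commutator ((1 / 2) *\<^sub>C (P + \<i> *\<^sub>C Q)) D))\<^sup>2
    = (norm (commutator P D))\<^sup>2 + (norm (commutator Q D))\<^sup>2"
proof -
  let ?K = "commutator P D" and ?S = "\<i> *\<^sub>C commutator Q D"
  have "conj_transpose ?K = - ?K"
    using assms by (simp add: conj_transpose_commutator self_adjoint_def)
  moreover have "conj_transpose ?S = ?S"
    using assms
    by (simp add: conj_transpose_cscale conj_transpose_commutator self_adjoint_def)
      (simp add: cscale_def vec_eq_iff)
  \<comment> \<open>Adjoints preserve the inner product but flip the sign of \<open>?K\<close>
    alone, so the inner product equals its own negative.\<close>
  ultimately have "?K \<bullet> ?S = 0"
    using inner_conj_transpose[of ?K ?S] by simp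
  then have "(norm (?K + ?S))\<^sup>2 = (norm ?K)\<^sup>2 + (norm ?S)\<^sup>2"
    by (simp add: power2_norm_eq_inner inner_add_left inner_add_right inner_commute)
  then show ?thesis
    by (simp add: commutator_cscale_left commutator_add_left norm_cscale norm_divide
        power_divide)
qed

section \<open>Nonscalar self-adjoint matrices and attainment of the malnormality constant\<close>

lemma centered_eq_0_imp_commutator_eq_0:
  assumes "centered A = 0" shows "commutator A B = 0"
proof -
  have "commutator A B = commutator (norm_trace A *\<^sub>C mat 1) B"
    using assms by (simp add: centered_def)
  then show ?thesis
    by (simp add: commutator_cscale_left) (simp add: commutator_def cscale_def vec_eq_iff)
qed

lemma exists_self_adjoint_nonscalar:
  assumes "CARD('n) \<ge> 2"
  shows "\<exists>B :: complex^'n^'n. self_adjoint B \<and> centered B \<noteq> 0"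
proof -
  obtain a b :: 'n where ab: "a \<noteq> b"
    using assms card_le_Suc0_iff_eq[of "UNIV :: 'n set"] by fastforce
  define B :: "complex^'n^'n" where "B = (\<chi> i j. if i = a \<and> j = a then 1 else 0)"
  have "self_adjoint B"
    by (auto simp: self_adjoint_def B_def conj_transpose_def vec_eq_iff)
  moreover have "centered B \<noteq> 0"
  proof
    assume "centered B = 0"
    then have "centered B $ a $ a = 0" "centered B $ b $ b = 0" by simp_all
    \<comment> \<open>The two diagonal entries are \<open>1 - norm_trace B\<close> and
      \<open>- norm_trace B\<close>, which cannot both vanish.\<close>
    then show False
      using ab by (simp add: centered_def B_def cscale_def mat_def)
  qed
  ultimately show ?thesis by blast
qed

text \<open>The admissible constants are exactly those up to the infimum of the quotients
  \<open>q B\<close> over nonscalar self-adjoint \<open>B\<close>, so this infimum is the greatest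
  one. The dimension bound makes the set of quotients nonempty.\<close>

lemma kappa_malnormal_mal:
  fixes X :: "complex^'n^'n"
  assumes "CARD('n) \<ge> 2" shows "kappa_malnormal (mal X) X"
proof -
  define S where "S = {B :: complex^'n^'n. self_adjoint B \<and> centered B \<noteq> 0}"
  define q where "q B = norm (commutator X B) / norm (centered B)" for B
  have S: "S \<noteq> {}"
    using exists_self_adjoint_nonscalar[OF assms] by (auto simp: S_def)
  have bdd: "bdd_below (q ` S)"
    by (rule bdd_belowI[of _ 0]) (auto simp: q_def)
  \<comment> \<open>A self-adjoint \<open>B\<close> outside \<open>S\<close> has
    \<open>centered B = 0\<close> and imposes no condition.\<close>
  have "kappa_malnormal \<kappa> X \<longleftrightarrow> (\<forall>B\<in>S. \<kappa> \<le> q B)" for \<kappa>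
    by (auto simp: kappa_malnormal_def norm2_eq_norm S_def q_def pos_le_divide_eq)
  then have iff: "kappa_malnormal \<kappa> X \<longleftrightarrow> \<kappa> \<le> Inf (q ` S)" for \<kappa>
    using le_cINF_iff[OF S bdd] by simp
  then have "mal X = Inf (q ` S)"
    unfolding mal_def by (intro Greatest_equality) auto
  then show ?thesis
    by (simp add: iff)
qed

section \<open>The expander inequality\<close>

lemma trace_averaging_map_pair:
  "trace (averaging_map [U, V] D ** D)
    = (trace (conj_transpose U ** D ** U ** D) + trace (conj_transpose V ** D ** V ** D)) / 2"
  by (simp add: averaging_map_def cscale_mult_left trace_cscale matrix_add_rdistrib trace_add)

theorem proposition3p5:
  fixes U V J :: "complex^'n^'n"
  assumes "CARD('n) \<ge> 2"
    and "unitary U" and "unitary V"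
    and "J = (1 / 2) *\<^sub>C (Re_mat U + \<i> *\<^sub>C Im_mat V)"
    and "malnormal J"
  shows "\<exists>\<delta>. 0 \<le> \<delta> \<and> \<delta> \<le> 1 - (mal J)\<^sup>2 \<and> quantum_edge_expander \<delta> [U, V]"
proof -
  let ?\<kappa> = "mal J"
  have pos: "?\<kappa> > 0"
    using assms(5) by (simp add: malnormal_def)
  have key: "4 * (?\<kappa>\<^sup>2 * (norm (centered B))\<^sup>2)
      \<le> (norm (commutator (Re_mat U) (centered B)))\<^sup>2 + (norm (commutator (Im_mat V) (centered B)))\<^sup>2"
    if "self_adjoint B" for B
  proof -
    have "?\<kappa> * norm (centered B) \<le> norm (commutator J (centered B))"
      using kappa_malnormal_mal[OF assms(1), of J] that
      by (simp add: kappa_malnormal_def norm2_eq_norm commutator_centered)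
    \<comment> \<open>Squaring keeps the inequality because \<open>mal J\<close> is positive, so the
      smaller side is nonnegative.\<close>
    then have "(?\<kappa> * norm (centered B))\<^sup>2 \<le> (norm (commutator J (centered B)))\<^sup>2"
      using pos by (intro power_mono) auto
    then show ?thesis
      using norm_commutator_cartesian_sq[OF self_adjoint_Re_mat[of U] self_adjoint_Im_mat[of V]
          self_adjoint_centered[OF that]]
      by (simp add: assms(4) power_mult_distrib)
  qed
  obtain B where B: "self_adjoint B" "centered B \<noteq> 0" "commutator (Re_mat U) B = 0"
  proof (cases "centered (Re_mat U) = 0")
    case True
    then show ?thesis
      using exists_self_adjoint_nonscalar[OF assms(1)] centered_eq_0_imp_commutator_eq_0 that
      by blast
  next
    case False
    then show ?thesis
      using that[OF self_adjoint_Re_mat] by (simp add: commutator_def)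
  qed
  have "norm (commutator (Im_mat V) (centered B)) \<le> 2 * norm (centered B)"
    using norm_commutator_Im_mat_le[OF self_adjoint_centered[OF B(1)], of V]
      norm_commutator_unitary_le[OF assms(3), of "centered B"] by linarith
  then have "(norm (commutator (Im_mat V) (centered B)))\<^sup>2 \<le> (2 * norm (centered B))\<^sup>2"
    by (intro power_mono) auto
  then have "?\<kappa>\<^sup>2 * (norm (centered B))\<^sup>2 \<le> 1 * (norm (centered B))\<^sup>2"
    using key[OF B(1)] B(3) by (simp add: commutator_centered power_mult_distrib)
  then have le1: "?\<kappa>\<^sup>2 \<le> 1"
    using B(2) by (subst (asm) mult_le_cancel_right) simp
  have "Re (trace (averaging_map [U, V] (centered B) ** centered B))
      \<le> (1 - ?\<kappa>\<^sup>2) * Re (trace (centered B ** centered B))" if "self_adjoint B" for B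
  proof -
    let ?D = "centered B"
    have D: "self_adjoint ?D"
      using that by (rule self_adjoint_centered)
    then have "Re (trace (?D ** ?D)) = (norm ?D)\<^sup>2"
      by (simp add: power2_norm_eq_inner inner_cmat_eq_trace self_adjoint_def)
    moreover have "(norm (commutator (Re_mat U) ?D))\<^sup>2 \<le> (norm (commutator U ?D))\<^sup>2"
      "(norm (commutator (Im_mat V) ?D))\<^sup>2 \<le> (norm (commutator V ?D))\<^sup>2"
      using D by (auto intro!: power_mono norm_commutator_Re_mat_le norm_commutator_Im_mat_le)
    \<comment> \<open>The identities for \<open>U\<close> and \<open>V\<close> add up to four times
      the squared norm of \<open>?D\<close> minus four times the averaged trace; the factor 4
      matches the one in \<open>key\<close>.\<close>
    ultimately show ?thesis
      using key[OF that] norm_commutator_unitary_sq[OF assms(2) D]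
        norm_commutator_unitary_sq[OF assms(3) D]
      by (simp add: trace_averaging_map_pair left_diff_distrib)
  qed
  \<comment> \<open>Here \<open>le1\<close> gives nonnegativity of the constant, and
    \<open>pos\<close> makes it strictly less than 1.\<close>
  then have "quantum_edge_expander (1 - ?\<kappa>\<^sup>2) [U, V]"
    using assms(2,3) pos le1 by (simp add: quantum_edge_expander_def)
  then show ?thesis
    using le1 by (intro exI[of _ "1 - ?\<kappa>\<^sup>2"]) simp
qed

end
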